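(* Let $f,g,h$ be smooth functions of $t$ with $f\neq0$, and consider the vector field $\mathbf v=\mathbf x_g+\mathbf y_h+\mathbf z_f$. The invariant functions $r$, $z$, $w$ of $\mathbf v$ are given by $$r=\frac{1}{f^{2/3}}\Big(y-\tfrac13 f^{2/3}G\Big),$$ $$z=\frac{1}{54f^{4/3}}\Big[54xf+3f^{2/3}hG-9y(h+yf')\Big]+\frac1{54}\Big[-9\int\Big(\frac{g}{f^{4/3}}+\frac{Gh'}{3f^{2/3}}+\frac19G^2f''\Big)dt+G^2f'\Big],$$ $$w=\frac{36uf^2-(h+2yf')^2+6f\big(g+2xf'+y(h'+yf'')\big)}{36f^{4/3}},$$ where $G=\int h f^{-5/3}\,dt$. The corresponding reduction of the ZK equation $u_{xt}-(uu_x)_x-u_{yy}=0$, obtained by setting $w=w(r,z)$, is the equation $$w_z^2+w\,w_{zz}+w_{rr}=0.$$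
   Context: Vector fields on $(t,x,y,u)$-space, for smooth functions $f,g,h$ of $t$ ($'=d/dt$): $\mathbf x_g=g\partial_x-g'\partial_u$, $\mathbf y_h=\tfrac12 yh'\partial_x+h\partial_y-\tfrac12 yh''\partial_u$, $\mathbf z_f=f\partial_t+\tfrac16(2xf'+y^2f'')\partial_x+\tfrac{2y}{3}f'\partial_y+\tfrac16(-4uf'-2xf''-y^2f''')\partial_u$. They are infinitesimal symmetries of the Zabolotskaya–Khokhlov (ZK) equation $u_{xt}-(uu_x)_x-u_{yy}=0$. An invariant of a vector field is a function annihilated by it. The reduced equation is the equation in two independent variables $r,z$ that results from rewriting the ZK equation in terms of the invariants, with $u(t,x,y)$ determined by $w=w(r,z)$.
   Formalization: As printed, r and z are not invariants of v (f=h=1, g=0: v=∂_t+∂_y, r=y−t/3, v(r)=2/3). The formal theorem keeps v but replaces g by 6g and h by 3h in the formulas for G, r, z, w; the reduced equation is unchanged. *)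

theory Defs
  imports "HOL-Analysis.Analysis"
begin

text \<open>
  Smoothness on an open set, by iterated directional derivatives.
\<close>

primrec Ck_on :: "nat \<Rightarrow> 'a::real_normed_vector set \<Rightarrow> ('a \<Rightarrow> real) \<Rightarrow> bool" where
  "Ck_on 0 S F \<longleftrightarrow> continuous_on S F"
| "Ck_on (Suc k) S F \<longleftrightarrow>
     (\<forall>p\<in>S. F differentiable (at p)) \<and> (\<forall>v. Ck_on k S (\<lambda>p. frechet_derivative F (at p) v))"

definition smooth_on :: "'a::real_normed_vector set \<Rightarrow> ('a \<Rightarrow> real) \<Rightarrow> bool" where
  "smooth_on S F \<longleftrightarrow> (\<forall>k. Ck_on k S F)"

definition antiderivative_on :: "real set \<Rightarrow> (real \<Rightarrow> real) \<Rightarrow> (real \<Rightarrow> real) \<Rightarrow> bool" where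
  "antiderivative_on I P q \<longleftrightarrow> (\<forall>t\<in>I. (P has_real_derivative q t) (at t))"

text \<open>
  \<open>thirds a k\<close> is \<open>a\<close> to the power \<open>k/3\<close>, by the real cube root, so that negative \<open>a\<close>
  are covered (\<open>powr\<close> is only meant for positive bases).
\<close>

definition thirds :: "real \<Rightarrow> int \<Rightarrow> real" where
  "thirds a k = root 3 a powi k"


text \<open>
  Points of the space are \<open>(t, x, y, u)\<close>; a vector field is the vector of its coefficients.
\<close>

type_synonym point = "real \<times> real \<times> real \<times> real"

definition field_x :: "(real \<Rightarrow> real) \<Rightarrow> point \<Rightarrow> point" where
  "field_x g = (\<lambda>(t, x, y, u). (0, g t, 0, - deriv g t))"

definition field_y :: "(real \<Rightarrow> real) \<Rightarrow> point \<Rightarrow> point" where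
  "field_y h = (\<lambda>(t, x, y, u).
     (0, 1/2 * y * deriv h t, h t, - (1/2 * y * deriv (deriv h) t)))"

definition field_z :: "(real \<Rightarrow> real) \<Rightarrow> point \<Rightarrow> point" where
  "field_z f = (\<lambda>(t, x, y, u).
     (f t,
      1/6 * (2 * x * deriv f t + y\<^sup>2 * deriv (deriv f) t),
      2 * y / 3 * deriv f t,
      1/6 * (- 4 * u * deriv f t - 2 * x * deriv (deriv f) t
              - y\<^sup>2 * deriv (deriv (deriv f)) t)))"

definition invariant_on :: "point set \<Rightarrow> (point \<Rightarrow> point) \<Rightarrow> (point \<Rightarrow> real) \<Rightarrow> bool" where
  "invariant_on \<Omega> V F \<longleftrightarrow>
     (\<forall>p\<in>\<Omega>. F differentiable (at p) \<and> frechet_derivative F (at p) (V p) = 0)"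

text \<open>
  ``The'' invariants of a field on a four-dimensional space: three invariants whose differentials
  are linearly independent at every point, and of which every other invariant is a function.
\<close>

definition complete_invariants ::
    "point set \<Rightarrow> (point \<Rightarrow> point) \<Rightarrow> (point \<Rightarrow> real) \<Rightarrow> (point \<Rightarrow> real) \<Rightarrow> (point \<Rightarrow> real) \<Rightarrow> bool" where
  "complete_invariants \<Omega> V F1 F2 F3 \<longleftrightarrow>
     invariant_on \<Omega> V F1 \<and> invariant_on \<Omega> V F2 \<and> invariant_on \<Omega> V F3 \<and>
     (\<forall>p\<in>\<Omega>. \<forall>a b c.
        (\<forall>d. a * frechet_derivative F1 (at p) d + b * frechet_derivative F2 (at p) d
              + c * frechet_derivative F3 (at p) d = 0)
        \<longrightarrow> a = 0 \<and> b = 0 \<and> c = 0) \<and>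
     (\<forall>F. invariant_on \<Omega> V F \<longrightarrow> (\<exists>\<Phi>. \<forall>p\<in>\<Omega>. F p = \<Phi> (F1 p) (F2 p) (F3 p)))"


text \<open>
  The explicit formulas. \<open>G\<close> and \<open>K\<close> stand for antiderivatives of \<open>G_integrand\<close> and
  \<open>K_integrand\<close>; the constants of integration are left free.
  These formulas are invariants of the field with \<open>g/6\<close>, \<open>h/3\<close>, \<open>f\<close> as parameters; for the
  field with parameters \<open>g\<close>, \<open>h\<close>, \<open>f\<close> they have to be taken at \<open>6 g\<close> and \<open>3 h\<close>. Without the
  scaling they fail: for \<open>f = h = 1\<close>, \<open>g = 0\<close> that field maps \<open>r = y - t/3\<close> to \<open>2/3\<close>.
\<close>

definition G_integrand :: "(real \<Rightarrow> real) \<Rightarrow> (real \<Rightarrow> real) \<Rightarrow> real \<Rightarrow> real" where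
  "G_integrand f h t = h t * thirds (f t) (-5)"

definition K_integrand ::
    "(real \<Rightarrow> real) \<Rightarrow> (real \<Rightarrow> real) \<Rightarrow> (real \<Rightarrow> real) \<Rightarrow> (real \<Rightarrow> real) \<Rightarrow> real \<Rightarrow> real" where
  "K_integrand f g h G t =
     g t / thirds (f t) 4 + G t * deriv h t / (3 * thirds (f t) 2)
     + 1/9 * (G t)\<^sup>2 * deriv (deriv f) t"

definition inv_r :: "(real \<Rightarrow> real) \<Rightarrow> (real \<Rightarrow> real) \<Rightarrow> real \<Rightarrow> real \<Rightarrow> real \<Rightarrow> real" where
  "inv_r f G t x y = 1 / thirds (f t) 2 * (y - 1/3 * thirds (f t) 2 * G t)"

definition inv_z ::
    "(real \<Rightarrow> real) \<Rightarrow> (real \<Rightarrow> real) \<Rightarrow> (real \<Rightarrow> real) \<Rightarrow> (real \<Rightarrow> real)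
      \<Rightarrow> real \<Rightarrow> real \<Rightarrow> real \<Rightarrow> real" where
  "inv_z f h G K t x y =
     1 / (54 * thirds (f t) 4)
       * (54 * x * f t + 3 * thirds (f t) 2 * h t * G t - 9 * y * (h t + y * deriv f t))
     + 1/54 * (- 9 * K t + (G t)\<^sup>2 * deriv f t)"

definition inv_w ::
    "(real \<Rightarrow> real) \<Rightarrow> (real \<Rightarrow> real) \<Rightarrow> (real \<Rightarrow> real)
      \<Rightarrow> real \<Rightarrow> real \<Rightarrow> real \<Rightarrow> real \<Rightarrow> real" where
  "inv_w f g h t x y u =
     (36 * u * (f t)\<^sup>2 - (h t + 2 * y * deriv f t)\<^sup>2
       + 6 * f t * (g t + 2 * x * deriv f t + y * (deriv h t + y * deriv (deriv f) t)))
     / (36 * thirds (f t) 4)"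


text \<open>The left-hand sides of the two equations; \<open>u_xt\<close> is the t-derivative of \<open>u_x\<close>.\<close>

definition zk_lhs :: "(real \<Rightarrow> real \<Rightarrow> real \<Rightarrow> real) \<Rightarrow> real \<Rightarrow> real \<Rightarrow> real \<Rightarrow> real" where
  "zk_lhs u t x y =
     deriv (\<lambda>t. deriv (\<lambda>x. u t x y) x) t
     - deriv (\<lambda>x. u t x y * deriv (\<lambda>x. u t x y) x) x
     - deriv (\<lambda>y. deriv (\<lambda>y. u t x y) y) y"

definition reduced_lhs :: "(real \<Rightarrow> real \<Rightarrow> real) \<Rightarrow> real \<Rightarrow> real \<Rightarrow> real" where
  "reduced_lhs w r z =
     (deriv (\<lambda>z. w r z) z)\<^sup>2
     + w r z * deriv (\<lambda>z. deriv (\<lambda>z. w r z) z) z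
     + deriv (\<lambda>r. deriv (\<lambda>r. w r z) r) r"

text \<open>
  The equation \<open>E = 0\<close> for \<open>u(t,x,y)\<close>, \<open>t \<in> I\<close>, is reduced to \<open>R = 0\<close> by the ansatz
  \<open>\<omega>(t,x,y,u) = w(\<rho>(t,x,y), \<zeta>(t,x,y))\<close>: for every twice continuously differentiable \<open>w\<close> on an
  open set \<open>D\<close>, the ansatz determines \<open>u\<close> on the preimage of \<open>D\<close>, and there the equation for
  \<open>u\<close> is, point by point, the equation for \<open>w\<close>; hence \<open>u\<close> is a solution on the preimage
  exactly if \<open>w\<close> is a solution on \<open>D\<close>. The last clause is stated separately because it also needs
  that every point of \<open>D\<close> is attained.
\<close>

definition reduces_to ::
    "real set \<Rightarrow> ((real \<Rightarrow> real \<Rightarrow> real \<Rightarrow> real) \<Rightarrow> real \<Rightarrow> real \<Rightarrow> real \<Rightarrow> real)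
      \<Rightarrow> (real \<Rightarrow> real \<Rightarrow> real \<Rightarrow> real) \<Rightarrow> (real \<Rightarrow> real \<Rightarrow> real \<Rightarrow> real)
      \<Rightarrow> (real \<Rightarrow> real \<Rightarrow> real \<Rightarrow> real \<Rightarrow> real)
      \<Rightarrow> ((real \<Rightarrow> real \<Rightarrow> real) \<Rightarrow> real \<Rightarrow> real \<Rightarrow> real) \<Rightarrow> bool" where
  "reduces_to I E \<rho> \<zeta> \<omega> R \<longleftrightarrow>
     (\<forall>D w. open D \<and> Ck_on 2 D (\<lambda>(r, z). w r z) \<longrightarrow>
        (let P = {(t, x, y). t \<in> I \<and> (\<rho> t x y, \<zeta> t x y) \<in> D} in
          (\<forall>(t, x, y)\<in>P. \<exists>!\<upsilon>. \<omega> t x y \<upsilon> = w (\<rho> t x y) (\<zeta> t x y)) \<and>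
          (\<forall>u. (\<forall>(t, x, y)\<in>P. \<omega> t x y (u t x y) = w (\<rho> t x y) (\<zeta> t x y)) \<longrightarrow>
             (\<forall>(t, x, y)\<in>P. E u t x y = 0 \<longleftrightarrow> R w (\<rho> t x y) (\<zeta> t x y) = 0) \<and>
             ((\<forall>(t, x, y)\<in>P. E u t x y = 0) \<longleftrightarrow> (\<forall>(r, z)\<in>D. R w r z = 0)))))"

end

theory Submission
  imports Defs
begin

text \<open>
  With \<open>a = f\<^sup>1\<^sup>/\<^sup>3\<close> and \<open>b = 1/a\<close> the three functions are polynomials in \<open>x, y, u\<close>, of triangular shape
  at fixed \<open>t\<close>: \<open>r\<close> is affine in \<open>y\<close>, \<open>z\<close> in \<open>x\<close>, and \<open>w\<close> in \<open>u\<close>, with leading coefficients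
  \<open>b\<^sup>2\<close>, \<open>b\<close> and \<open>a\<^sup>2\<close>. Hence \<open>(t, r, z, w)\<close> are global coordinates, in which the field is
  \<open>f \<partial>\<^sub>t\<close>; an invariant is constant in \<open>t\<close> because \<open>I\<close> is an interval. Substituting the ansatz, solved
  for \<open>u\<close>, the ZK expression becomes \<open>- b\<^sup>6\<close> times the reduced one.
\<close>

section \<open>Smoothness on open sets, and derivatives of functions of one variable\<close>

lemma Ck_on_cong:
  assumes "open S" "\<And>p. p \<in> S \<Longrightarrow> F p = H p" "Ck_on k S F"
  shows "Ck_on k S H"
  using assms
proof (induction k arbitrary: F H)
  case 0
  then show ?case by (auto cong: continuous_on_cong)
next
  case (Suc k)
  \<comment> \<open>Openness of \<open>S\<close> carries the derivative of \<open>F\<close> over to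
    \<open>H\<close>. The directional derivatives then agree on \<open>S\<close>, which is the
    situation of the induction hypothesis.\<close>
  have H: "(H has_derivative frechet_derivative F (at p)) (at p)" if "p \<in> S" for p
    using Suc.prems that
    by (auto simp: frechet_derivative_works intro: has_derivative_transform_within_open[of F _ _ UNIV S])
  have "frechet_derivative H (at p) = frechet_derivative F (at p)" if "p \<in> S" for p
    using frechet_derivative_at[OF H[OF that]] by simp
  moreover have "H differentiable (at p)" if "p \<in> S" for p
    using H[OF that] by (rule differentiableI)
  ultimately show ?case
    using Suc.prems(3) Suc.IH[OF Suc.prems(1)] by (simp; metis)
qed

lemma Ck_on_Suc_imp_Ck_on_derivative:
  "Ck_on (Suc k) S F \<Longrightarrow> Ck_on k S (\<lambda>p. frechet_derivative F (at p) v)"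
  by simp

lemma smooth_on_has_deriv:
  fixes F :: "real \<Rightarrow> real"
  assumes "smooth_on S F" "t \<in> S"
  shows "(F has_real_derivative deriv F t) (at t)"
proof -
  have "Ck_on (Suc 0) S F" using assms(1) unfolding smooth_on_def by blast
  hence "F differentiable (at t)" using assms(2) by simp
  thus ?thesis
    using DERIV_imp_deriv real_differentiable_def by auto
qed

text \<open>On the line the derivative in direction 1 is \<open>deriv F\<close>, but this is known
  only at points of \<open>S\<close>; \<open>Ck_on_cong\<close> makes the exchange possible.\<close>

lemma smooth_on_deriv:
  fixes F :: "real \<Rightarrow> real"
  assumes "open S" "smooth_on S F"
  shows "smooth_on S (deriv F)"
  unfolding smooth_on_def
proof
  fix k
  have "Ck_on k S (\<lambda>p. frechet_derivative F (at p) 1)"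
    using assms(2) by (intro Ck_on_Suc_imp_Ck_on_derivative) (simp only: smooth_on_def)
  moreover have "frechet_derivative F (at t) 1 = deriv F t" if "t \<in> S" for t
  proof -
    have "(F has_derivative (*) (deriv F t)) (at t)"
      using smooth_on_has_deriv[OF assms(2) that] by (rule has_field_derivative_imp_has_derivative)
    from frechet_derivative_at[OF this, symmetric] show ?thesis by simp
  qed
  ultimately show "Ck_on k S (deriv F)"
    by (rule Ck_on_cong[OF assms(1), rotated 1])
qed

subsection \<open>Partial derivatives in the plane\<close>

text \<open>The mean value theorem is used twice: in \<open>x\<close> for the difference of
  \<open>F\<close> at the two heights, then in \<open>y\<close> for \<open>Fx\<close>.\<close>

lemma second_difference_mvt:
  fixes F :: "real \<Rightarrow> real \<Rightarrow> real"
  assumes "e > 0"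
    and "\<And>x y. \<lbrakk>x \<in> {r..r+e}; y \<in> {z..z+e}\<rbrakk> \<Longrightarrow> ((\<lambda>x. F x y) has_real_derivative Fx x y) (at x)"
    and "\<And>x y. \<lbrakk>x \<in> {r..r+e}; y \<in> {z..z+e}\<rbrakk> \<Longrightarrow> ((\<lambda>y. Fx x y) has_real_derivative Fxy x y) (at y)"
  obtains x y where "x \<in> {r..r+e}" "y \<in> {z..z+e}"
    "F (r+e) (z+e) - F (r+e) z - F r (z+e) + F r z = e\<^sup>2 * Fxy x y"
proof -
  have "((\<lambda>x. F x (z+e) - F x z) has_real_derivative Fx x (z+e) - Fx x z) (at x)"
    if "r \<le> x" "x \<le> r+e" for x
    using that assms(1) by (intro derivative_intros assms(2)) auto
  from MVT2[of r "r+e", OF _ this] assms(1) obtain x where x: "r < x" "x < r+e"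
    "F (r+e) (z+e) - F (r+e) z - (F r (z+e) - F r z) = e * (Fx x (z+e) - Fx x z)"
    by auto
  from MVT2[of z "z+e" "Fx x" "Fxy x"] assms(1,3) x obtain y where y: "z < y" "y < z+e"
    "Fx x (z+e) - Fx x z = e * Fxy x y"
    by auto
  show thesis
    by (rule that[of x y]) (use x y in \<open>auto simp: power2_eq_square\<close>)
qed

lemma isCont_case_prodE:
  fixes F :: "real \<Rightarrow> real \<Rightarrow> real"
  assumes "isCont (\<lambda>(x, y). F x y) (r, z)" "\<epsilon> > 0"
  obtains d where "d > 0" "\<And>x y. dist (x, y) (r, z) < d \<Longrightarrow> \<bar>F x y - F r z\<bar> < \<epsilon>"
proof -
  from assms obtain d where d: "d > 0"
    "\<And>q. dist q (r, z) < d \<Longrightarrow> dist (case_prod F q) (case_prod F (r, z)) < \<epsilon>"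
    unfolding continuous_at_eps_delta by blast
  show thesis
    using d(1) d(2)[of "(_, _)"] by (intro that[of d]) (simp_all add: dist_real_def)
qed

text \<open>Clairaut's theorem. The second difference over a square is symmetric in the two
  coordinates, so it yields a value of \<open>F12\<close> and a value of \<open>F21\<close> that
  coincide; on a small square continuity would keep them apart.\<close>

lemma mixed_partials_eq:
  fixes F :: "real \<Rightarrow> real \<Rightarrow> real"
  assumes "open D" "(r, z) \<in> D"
    and "\<And>x y. (x, y) \<in> D \<Longrightarrow> ((\<lambda>x. F x y) has_real_derivative F1 x y) (at x)"
    and "\<And>x y. (x, y) \<in> D \<Longrightarrow> ((\<lambda>y. F x y) has_real_derivative F2 x y) (at y)"
    and "\<And>x y. (x, y) \<in> D \<Longrightarrow> ((\<lambda>y. F1 x y) has_real_derivative F12 x y) (at y)"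
    and "\<And>x y. (x, y) \<in> D \<Longrightarrow> ((\<lambda>x. F2 x y) has_real_derivative F21 x y) (at x)"
    and "continuous_on D (\<lambda>(x, y). F12 x y)" "continuous_on D (\<lambda>(x, y). F21 x y)"
  shows "F12 r z = F21 r z"
proof (rule ccontr)
  assume "F12 r z \<noteq> F21 r z"
  \<comment> \<open>Half the gap: values within \<open>\<epsilon>\<close> of the two different
    limits cannot be equal.\<close>
  define \<epsilon> where "\<epsilon> = \<bar>F12 r z - F21 r z\<bar> / 2"
  have "\<epsilon> > 0" using \<open>F12 r z \<noteq> F21 r z\<close> by (simp add: \<epsilon>_def)
  have "isCont (\<lambda>(x, y). F12 x y) (r, z)" "isCont (\<lambda>(x, y). F21 x y) (r, z)"
    using assms(1,2,7,8) by (auto simp: continuous_on_eq_continuous_at)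
  then obtain d1 d2 where d1: "d1 > 0" "\<And>x y. dist (x, y) (r, z) < d1 \<Longrightarrow> \<bar>F12 x y - F12 r z\<bar> < \<epsilon>"
    and d2: "d2 > 0" "\<And>x y. dist (x, y) (r, z) < d2 \<Longrightarrow> \<bar>F21 x y - F21 r z\<bar> < \<epsilon>"
    using isCont_case_prodE[OF _ \<open>\<epsilon> > 0\<close>] by metis
  obtain d3 where d3: "d3 > 0" "ball (r, z) d3 \<subseteq> D"
    using assms(1,2) open_contains_ball by blast
  \<comment> \<open>Points of the square are at distance at most \<open>2 * e\<close> from its
    corner, so a third of the radius keeps the inequality strict.\<close>
  define e where "e = min d1 (min d2 d3) / 3"
  have e: "e > 0" using d1(1) d2(1) d3(1) by (simp add: e_def)
  have near: "dist (x, y) (r, z) < min d1 (min d2 d3)" if "x \<in> {r..r+e}" "y \<in> {z..z+e}" for x y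
  proof -
    have "dist (x, y) (r, z) \<le> \<bar>x - r\<bar> + \<bar>y - z\<bar>"
      using sqrt_sum_squares_le_sum_abs[of "x - r" "y - z"] by (simp add: dist_Pair_Pair dist_real_def)
    also have "\<dots> \<le> 2 * e" using that by auto
    also have "\<dots> < min d1 (min d2 d3)" using e unfolding e_def by linarith
    finally show ?thesis .
  qed
  have inD: "(x, y) \<in> D" if "x \<in> {r..r+e}" "y \<in> {z..z+e}" for x y
    using near[OF that] d3(2) by (auto simp: dist_commute subset_iff)
  obtain x y where xy: "x \<in> {r..r+e}" "y \<in> {z..z+e}"
    "F (r+e) (z+e) - F (r+e) z - F r (z+e) + F r z = e\<^sup>2 * F12 x y"
    by (rule second_difference_mvt[of e r z F F1 F12]) (use e inD assms(3,5) in auto)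
  \<comment> \<open>The same lemma with the two coordinates exchanged.\<close>
  obtain y' x' where yx: "y' \<in> {z..z+e}" "x' \<in> {r..r+e}"
    "F (r+e) (z+e) - F r (z+e) - F (r+e) z + F r z = e\<^sup>2 * F21 x' y'"
    by (rule second_difference_mvt[of e z r "\<lambda>y x. F x y" "\<lambda>y x. F2 x y" "\<lambda>y x. F21 x y"])
      (use e inD assms(4,6) in auto)
  have "e\<^sup>2 * F12 x y = e\<^sup>2 * F21 x' y'" using xy(3) yx(3) by linarith
  hence "F12 x y = F21 x' y'" using e by simp
  moreover have "\<bar>F12 x y - F12 r z\<bar> < \<epsilon>" "\<bar>F21 x' y' - F21 r z\<bar> < \<epsilon>"
    using d1(2) d2(2) near xy(1,2) yx(1,2) by simp_all
  ultimately show False unfolding \<epsilon>_def by (auto simp: abs_if split: if_splits)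
qed

text \<open>The total derivative in coordinates, stronger than existence of the two partial
  derivatives; this is what the chain rule requires.\<close>

definition has_partials :: "(real \<times> real \<Rightarrow> real) \<Rightarrow> real \<Rightarrow> real \<Rightarrow> real \<times> real \<Rightarrow> bool" where
  "has_partials F A B p \<longleftrightarrow> (F has_derivative (\<lambda>(d, e). A * d + B * e)) (at p)"

lemma has_partials_chain:
  assumes "has_partials F A B (\<rho> s, \<zeta> s)"
    and "(\<rho> has_real_derivative \<rho>') (at s)" "(\<zeta> has_real_derivative \<zeta>') (at s)"
  shows "((\<lambda>s. F (\<rho> s, \<zeta> s)) has_real_derivative A * \<rho>' + B * \<zeta>') (at s)"
proof -
  have "((\<lambda>s. (\<rho> s, \<zeta> s)) has_derivative (\<lambda>d. (\<rho>' * d, \<zeta>' * d))) (at s)"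
    using assms(2,3) unfolding has_field_derivative_def by (rule has_derivative_Pair)
  from has_derivative_compose[OF this assms(1)[unfolded has_partials_def]]
  show ?thesis
    unfolding has_field_derivative_def
    by (rule has_derivative_eq_rhs) (auto simp: fun_eq_iff algebra_simps)
qed

lemma has_partials_fst:
  "has_partials F A B (x, y) \<Longrightarrow> ((\<lambda>x. F (x, y)) has_real_derivative A) (at x)"
  using has_partials_chain[of F A B "\<lambda>x. x" x "\<lambda>x. y" 1 0] by auto

lemma has_partials_snd:
  "has_partials F A B (x, y) \<Longrightarrow> ((\<lambda>y. F (x, y)) has_real_derivative B) (at y)"
  using has_partials_chain[of F A B "\<lambda>y. x" y "\<lambda>y. y" 0 1] by auto

lemma differentiable_imp_has_partials:
  assumes "F differentiable (at p)"
  shows "has_partials F (frechet_derivative F (at p) (1, 0)) (frechet_derivative F (at p) (0, 1)) p"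
proof -
  let ?F = "frechet_derivative F (at p)"
  have d: "(F has_derivative ?F) (at p)" using assms frechet_derivative_works by blast
  have "?F (d, e) = (case (d, e) of (d, e) \<Rightarrow> A * d + B * e)"
    if "A = ?F (1, 0)" "B = ?F (0, 1)" for d e A B
  proof -
    have "?F (d *\<^sub>R (1, 0) + e *\<^sub>R (0, 1)) = d *\<^sub>R A + e *\<^sub>R B"
      using has_derivative_linear[OF d] unfolding that by (simp only: linear_add linear_scale)
    thus ?thesis by (simp add: mult.commute)
  qed
  from this[OF refl refl] show ?thesis
    unfolding has_partials_def by (intro has_derivative_eq_rhs[OF d] ext) (metis surj_pair)
qed

text \<open>Turns the abstract regularity of \<open>w\<close> into explicit first and second
  derivatives. That a single \<open>w12\<close> serves both \<open>w1\<close> and \<open>w2\<close>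
  is Clairaut's theorem.\<close>

lemma C2_imp_partials:
  fixes w :: "real \<Rightarrow> real \<Rightarrow> real"
  assumes "open D" "Ck_on 2 D (\<lambda>(r, z). w r z)"
  obtains w1 w2 w11 w12 w22 where
    "\<forall>p\<in>D. has_partials (\<lambda>(r, z). w r z) (w1 p) (w2 p) p"
    "\<forall>p\<in>D. has_partials w1 (w11 p) (w12 p) p"
    "\<forall>p\<in>D. has_partials w2 (w12 p) (w22 p) p"
proof -
  define W where "W = (\<lambda>(r, z). w r z)"
  define w1 where "w1 = (\<lambda>p. frechet_derivative W (at p) (1, 0))"
  define w2 where "w2 = (\<lambda>p. frechet_derivative W (at p) (0, 1))"
  define w11 where "w11 = (\<lambda>p. frechet_derivative w1 (at p) (1, 0))"
  define w12 where "w12 = (\<lambda>p. frechet_derivative w1 (at p) (0, 1))"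
  define w21 where "w21 = (\<lambda>p. frechet_derivative w2 (at p) (1, 0))"
  define w22 where "w22 = (\<lambda>p. frechet_derivative w2 (at p) (0, 1))"
  have C: "Ck_on (Suc (Suc 0)) D W" using assms(2) by (simp add: W_def numeral_2_eq_2)
  have C1: "Ck_on (Suc 0) D w1" and C2: "Ck_on (Suc 0) D w2"
    unfolding w1_def w2_def using C by (blast intro: Ck_on_Suc_imp_Ck_on_derivative)+
  have P: "has_partials W (w1 p) (w2 p) p" if "p \<in> D" for p
    unfolding w1_def w2_def by (rule differentiable_imp_has_partials) (use C that in simp)
  have P1: "has_partials w1 (w11 p) (w12 p) p" if "p \<in> D" for p
    unfolding w11_def w12_def by (rule differentiable_imp_has_partials) (use C1 that in simp)
  have P2: "has_partials w2 (w21 p) (w22 p) p" if "p \<in> D" for p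
    unfolding w21_def w22_def by (rule differentiable_imp_has_partials) (use C2 that in simp)
  have cont: "continuous_on D w12" "continuous_on D w21"
    using C1 C2 by (auto simp: w12_def w21_def)
  have "w12 (r, z) = w21 (r, z)" if "(r, z) \<in> D" for r z
    by (rule mixed_partials_eq[OF assms(1) that, of "\<lambda>x y. W (x, y)" "\<lambda>x y. w1 (x, y)" "\<lambda>x y. w2 (x, y)"
          "\<lambda>x y. w12 (x, y)" "\<lambda>x y. w21 (x, y)"])
      (use cont in \<open>auto intro: has_partials_fst[OF P] has_partials_snd[OF P] has_partials_snd[OF P1] has_partials_fst[OF P2]\<close>)
  hence "has_partials w2 (w12 p) (w22 p) p" if "p \<in> D" for p
    using P2[OF that] that by (cases p) simp
  with P P1 show thesis using that unfolding W_def by blast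
qed

subsection \<open>Invariants\<close>

text \<open>All three invariants have this shape in \<open>x\<close>, \<open>y\<close>,
  \<open>u\<close>, so one computation gives all their differentials.\<close>

lemma has_derivative_quadratic_coeffs:
  fixes c0 c1 c2 c3 c4 :: "real \<Rightarrow> real"
  assumes "(c0 has_real_derivative d0) (at t)" "(c1 has_real_derivative d1) (at t)"
    "(c2 has_real_derivative d2) (at t)" "(c3 has_real_derivative d3) (at t)"
    "(c4 has_real_derivative d4) (at t)"
  shows "((\<lambda>(t, x, y, u). c0 t + c1 t * x + c2 t * y + c3 t * y\<^sup>2 + c4 t * u) has_derivative
     (\<lambda>(dt, dx, dy, du). (d0 + d1 * x + d2 * y + d3 * y\<^sup>2 + d4 * u) * dt + c1 t * dx
        + (c2 t + 2 * c3 t * y) * dy + c4 t * du)) (at (t, x, y, u))"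
proof -
  have c: "((\<lambda>p. c (fst p)) has_derivative (\<lambda>p. fst p * d)) (at (t, x, y, u))"
    if "(c has_real_derivative d) (at t)" for c d
    by (rule DERIV_compose_FDERIV) (use that in \<open>auto intro!: derivative_eq_intros\<close>)
  show ?thesis
    unfolding case_prod_beta
    by (auto intro!: derivative_eq_intros c assms simp: algebra_simps power2_eq_square)
qed

lemma has_real_derivative_along_line:
  assumes "(H has_derivative H') (at (c t))" "(c has_derivative (\<lambda>d. d *\<^sub>R v)) (at t)"
  shows "((\<lambda>s. H (c s)) has_real_derivative H' v) (at t)"
proof -
  have "((\<lambda>s. H (c s)) has_derivative (\<lambda>d. H' (d *\<^sub>R v))) (at t)"
    by (rule has_derivative_compose[OF assms(2,1)])
  moreover have "H' (d *\<^sub>R v) = H' v * d" for d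
    using linear_scale[OF has_derivative_linear[OF assms(1)]] by simp
  ultimately show ?thesis by (simp add: has_field_derivative_def)
qed

text \<open>\<open>deriv\<close> depends only on the function near \<open>t\<close>, and the
  parameters that \<open>c\<close> sends into the open set \<open>P\<close> form a neighbourhood of
  \<open>t\<close>. This permits iterated derivatives of functions whose formula is known on
  \<open>P\<close> alone.\<close>

lemma deriv_eq_on_open_slice:
  fixes c :: "real \<Rightarrow> 'a::topological_space" and \<phi> \<psi> :: "real \<Rightarrow> real"
  assumes "open P" "continuous_on UNIV c" "c t \<in> P"
    and "\<And>s. c s \<in> P \<Longrightarrow> \<phi> s = \<psi> s" "(\<psi> has_real_derivative d) (at t)"
  shows "deriv \<phi> t = d"
proof -
  have "open (c -` P)" using assms(1,2) by (rule open_vimage)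
  thus ?thesis
    using assms(3-5)
    by (intro DERIV_imp_deriv, elim has_field_derivative_transform_within_open) auto
qed

lemma reduced_lhs_eq:
  fixes w :: "real \<Rightarrow> real \<Rightarrow> real"
  assumes "open D"
    and w: "\<And>p. p \<in> D \<Longrightarrow> has_partials (\<lambda>(r, z). w r z) (p1 p) (p2 p) p"
    and p1: "\<And>p. p \<in> D \<Longrightarrow> has_partials p1 (p11 p) (p12 p) p"
    and p2: "\<And>p. p \<in> D \<Longrightarrow> has_partials p2 (p12 p) (p22 p) p"
    and "(r, z) \<in> D"
  shows "reduced_lhs w r z = (p2 (r, z))\<^sup>2 + w r z * p22 (r, z) + p11 (r, z)"
proof -
  have wr: "deriv (\<lambda>r. w r z) r = p1 (r, z)" and wz: "deriv (\<lambda>z. w r z) z = p2 (r, z)" if "(r, z) \<in> D" for r z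
    using has_partials_fst[OF w[OF that]] has_partials_snd[OF w[OF that]] by (auto intro: DERIV_imp_deriv)
  have "deriv (\<lambda>r. deriv (\<lambda>r. w r z) r) r = p11 (r, z)"
    by (rule deriv_eq_on_open_slice[OF assms(1), where c = "\<lambda>r. (r, z)"])
      (use assms(5) wr has_partials_fst[OF p1] in \<open>auto intro!: continuous_intros\<close>)
  moreover have "deriv (\<lambda>z. deriv (\<lambda>z. w r z) z) z = p22 (r, z)"
    by (rule deriv_eq_on_open_slice[OF assms(1), where c = "\<lambda>z. (r, z)"])
      (use assms(5) wz has_partials_snd[OF p2] in \<open>auto intro!: continuous_intros\<close>)
  ultimately show ?thesis
    unfolding reduced_lhs_def wz[OF assms(5)] by simp
qed

section \<open>The standing assumptions, and the cube root of \<open>f\<close> with its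
  inverse\<close>

locale zk_data =
  fixes I :: "real set" and f g h G K :: "real \<Rightarrow> real"
  assumes open_I: "open I" and connected_I: "connected I" and nonempty_I: "I \<noteq> {}"
    and smooth: "smooth_on I f" "smooth_on I g" "smooth_on I h"
    and f_nonzero: "\<And>t. t \<in> I \<Longrightarrow> f t \<noteq> 0"
    and G: "antiderivative_on I G (G_integrand f (\<lambda>t. 3 * h t))"
    and K: "antiderivative_on I K (K_integrand f (\<lambda>t. 6 * g t) (\<lambda>t. 3 * h t) G)"
begin

abbreviation "f1 \<equiv> deriv f"
abbreviation "f2 \<equiv> deriv f1"
abbreviation "f3 \<equiv> deriv f2"
abbreviation "g1 \<equiv> deriv g"
abbreviation "h1 \<equiv> deriv h"
abbreviation "h2 \<equiv> deriv h1"

definition a :: "real \<Rightarrow> real" where "a t = root 3 (f t)"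
text \<open>Negative powers of the root become powers of \<open>b\<close>, so the formulas turn into
  polynomials subject to \<open>a t * b t = 1\<close>.\<close>

definition b :: "real \<Rightarrow> real" where "b t = inverse (a t)"

lemma f_eq: "f t = a t ^ 3"
  by (simp add: a_def odd_real_root_pow)

lemma ab: "t \<in> I \<Longrightarrow> a t * b t = 1"
  using f_nonzero by (simp add: a_def b_def)

lemma a_nonzero: "t \<in> I \<Longrightarrow> a t \<noteq> 0"
  using ab by fastforce

lemma deriv_facts:
  assumes "t \<in> I"
  shows "(f has_real_derivative f1 t) (at t)" "(f1 has_real_derivative f2 t) (at t)"
    "(f2 has_real_derivative f3 t) (at t)" "(g has_real_derivative g1 t) (at t)"
    "(h has_real_derivative h1 t) (at t)" "(h1 has_real_derivative h2 t) (at t)"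
  using assms smooth open_I by (auto intro: smooth_on_has_deriv smooth_on_deriv)

lemma deriv_3h: "t \<in> I \<Longrightarrow> deriv (\<lambda>t. 3 * h t) t = 3 * h1 t"
  by (rule DERIV_imp_deriv) (auto intro!: derivative_eq_intros deriv_facts)

lemma deriv_a:
  assumes "t \<in> I"
  shows "(a has_real_derivative f1 t * (b t)\<^sup>2 / 3) (at t)"
proof -
  have "(root 3 has_real_derivative (b t)\<^sup>2 / 3) (at (f t))"
    using DERIV_odd_real_root[of 3 "f t"] f_nonzero[OF assms]
    by (simp add: a_def b_def field_simps)
  from DERIV_chain2[OF this deriv_facts(1)[OF assms]] show ?thesis
    unfolding a_def[abs_def] by (simp add: mult.commute)
qed

lemma deriv_b:
  assumes "t \<in> I"
  shows "(b has_real_derivative - f1 t * b t ^ 4 / 3) (at t)"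
proof -
  have "((\<lambda>t. inverse (a t)) has_real_derivative - (b t * (f1 t * (b t)\<^sup>2 / 3) * b t)) (at t)"
    unfolding b_def[of t] by (rule DERIV_inverse') (use deriv_a assms a_nonzero b_def in auto)
  thus ?thesis unfolding b_def[abs_def] by (simp add: power2_eq_square power4_eq_xxxx mult_ac)
qed

lemma thirds_f:
  "thirds (f t) 2 = (a t)\<^sup>2" "thirds (f t) 4 = a t ^ 4" "thirds (f t) (-5) = b t ^ 5"
  unfolding thirds_def a_def[symmetric] b_def power_int_minus power_inverse by simp_all

text \<open>Valid for every \<open>t\<close>, even where \<open>a t = 0\<close>, since division is
  multiplication by the total function \<open>inverse\<close>.\<close>

lemma divide_a_powers:
  "x / (a t)\<^sup>2 = x * (b t)\<^sup>2" "x / (c * (a t)\<^sup>2) = x * (b t)\<^sup>2 / c"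
  "x / a t ^ 4 = x * b t ^ 4" "x / (c * a t ^ 4) = x * b t ^ 4 / c"
  by (simp_all only: b_def power_inverse divide_inverse inverse_mult_distrib mult_ac)

lemma deriv_G:
  assumes "t \<in> I"
  shows "(G has_real_derivative 3 * h t * b t ^ 5) (at t)"
  using G assms by (simp add: antiderivative_on_def G_integrand_def thirds_f)

lemma deriv_K:
  assumes "t \<in> I"
  shows "(K has_real_derivative
     6 * g t * b t ^ 4 + G t * h1 t * (b t)\<^sup>2 + 1/9 * (G t)\<^sup>2 * f2 t) (at t)"
proof -
  have "K_integrand f (\<lambda>t. 6 * g t) (\<lambda>t. 3 * h t) G t
      = 6 * g t * b t ^ 4 + G t * h1 t * (b t)\<^sup>2 + 1/9 * (G t)\<^sup>2 * f2 t"
    by (simp add: K_integrand_def thirds_f deriv_3h[OF assms] divide_a_powers)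
  moreover have "(K has_real_derivative K_integrand f (\<lambda>t. 6 * g t) (\<lambda>t. 3 * h t) G t) (at t)"
    using K assms unfolding antiderivative_on_def by blast
  ultimately show ?thesis by simp
qed

section \<open>The invariants as polynomials in \<open>x\<close>, \<open>y\<close>,
  \<open>u\<close>, and the derivatives of their coefficients\<close>

lemmas coeff_derivs = deriv_facts deriv_a deriv_b deriv_G deriv_K

text \<open>The letter names the invariant; the index 0, 1, 2, 3, 4 marks the coefficient of 1,
  \<open>x\<close>, \<open>y\<close>, \<open>y\<^sup>2\<close>, \<open>u\<close>. The coefficient of
  \<open>x\<close> in the second invariant is \<open>b\<close> itself. Unlike these,
  \<open>f1\<close>, \<open>g1\<close>, \<open>h1\<close> and so on are derivatives.\<close>

definition "r0 t = - G t / 3"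
definition "r2 t = (b t)\<^sup>2"
definition "z0 t = h t * G t * (b t)\<^sup>2 / 6 - K t / 6 + (G t)\<^sup>2 * f1 t / 54"
definition "z2 t = - h t * b t ^ 4 / 2"
definition "z3 t = - f1 t * b t ^ 4 / 6"
definition "w0 t = g t * b t - (h t)\<^sup>2 * b t ^ 4 / 4"
definition "w1 t = f1 t * b t / 3"
definition "w2 t = h1 t * b t / 2 - h t * f1 t * b t ^ 4 / 3"
definition "w3 t = f2 t * b t / 6 - (f1 t)\<^sup>2 * b t ^ 4 / 9"
definition "w4 t = (a t)\<^sup>2"

lemmas coeff_defs = r0_def r2_def z0_def z2_def z3_def w0_def w1_def w2_def w3_def w4_def

lemma a_b_powers:
  assumes "t \<in> I"
  shows "(a t)\<^sup>2 * (b t)\<^sup>2 = 1" "(a t)\<^sup>2 * b t ^ 4 = (b t)\<^sup>2"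
    "f t * b t ^ 4 = b t" "(f t)\<^sup>2 * b t ^ 4 = (a t)\<^sup>2"
proof -
  have *: "\<alpha>\<^sup>2 * \<beta>\<^sup>2 = 1" "\<alpha>\<^sup>2 * \<beta> ^ 4 = \<beta>\<^sup>2" "\<alpha> ^ 3 * \<beta> ^ 4 = \<beta>" "(\<alpha> ^ 3)\<^sup>2 * \<beta> ^ 4 = \<alpha>\<^sup>2"
    if "\<alpha> * \<beta> = 1" for \<alpha> \<beta> :: real
  proof -
    have "\<alpha> \<noteq> 0" "\<beta> = inverse \<alpha>" using that by (auto intro: inverse_unique[symmetric])
    thus "\<alpha>\<^sup>2 * \<beta>\<^sup>2 = 1" "\<alpha>\<^sup>2 * \<beta> ^ 4 = \<beta>\<^sup>2" "\<alpha> ^ 3 * \<beta> ^ 4 = \<beta>"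
      "(\<alpha> ^ 3)\<^sup>2 * \<beta> ^ 4 = \<alpha>\<^sup>2"
      by (simp_all add: field_simps eval_nat_numeral)
  qed
  show "(a t)\<^sup>2 * (b t)\<^sup>2 = 1" "(a t)\<^sup>2 * b t ^ 4 = (b t)\<^sup>2"
    "f t * b t ^ 4 = b t" "(f t)\<^sup>2 * b t ^ 4 = (a t)\<^sup>2"
    using *[OF ab[OF assms]] by (simp_all only: f_eq[of t])
qed

lemma inv_r_eq:
  assumes "t \<in> I"
  shows "inv_r f G t x y = r0 t + r2 t * y"
proof -
  have "inv_r f G t x y = (b t)\<^sup>2 * y - ((a t)\<^sup>2 * (b t)\<^sup>2) * G t / 3"
    by (simp add: inv_r_def thirds_f divide_a_powers algebra_simps)
  thus ?thesis by (simp add: a_b_powers[OF assms] coeff_defs)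
qed

lemma inv_z_eq:
  assumes "t \<in> I"
  shows "inv_z f (\<lambda>t. 3 * h t) G K t x y = z0 t + b t * x + z2 t * y + z3 t * y\<^sup>2"
proof -
  \<comment> \<open>The products \<open>f t * b t ^ 4\<close> and
    \<open>(a t)\<^sup>2 * b t ^ 4\<close> are kept together so that \<open>a_b_powers\<close> can
    collapse them.\<close>
  have "inv_z f (\<lambda>t. 3 * h t) G K t x y
      = (f t * b t ^ 4) * x + ((a t)\<^sup>2 * b t ^ 4) * (h t * G t) / 6
        - b t ^ 4 * y * (3 * h t + y * f1 t) / 6 + (- 9 * K t + (G t)\<^sup>2 * f1 t) / 54"
    unfolding inv_z_def thirds_f divide_a_powers by (simp add: field_simps)
  also have "\<dots> = z0 t + b t * x + z2 t * y + z3 t * y\<^sup>2"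
    unfolding a_b_powers[OF assms] coeff_defs by (simp add: field_simps power2_eq_square)
  finally show ?thesis .
qed

lemma inv_w_eq:
  assumes "t \<in> I"
  shows "inv_w f (\<lambda>t. 6 * g t) (\<lambda>t. 3 * h t) t x y u
     = w0 t + w1 t * x + w2 t * y + w3 t * y\<^sup>2 + w4 t * u"
proof -
  have "inv_w f (\<lambda>t. 6 * g t) (\<lambda>t. 3 * h t) t x y u
      = ((f t)\<^sup>2 * b t ^ 4) * u - b t ^ 4 * (3 * h t + 2 * y * f1 t)\<^sup>2 / 36
        + (f t * b t ^ 4) * (6 * g t + 2 * x * f1 t + y * (3 * h1 t + y * f2 t)) / 6"
    unfolding inv_w_def thirds_f deriv_3h[OF assms] divide_a_powers by (simp add: field_simps)
  also have "\<dots> = w0 t + w1 t * x + w2 t * y + w3 t * y\<^sup>2 + w4 t * u"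
    unfolding a_b_powers[OF assms] coeff_defs by (simp add: field_simps power2_eq_square)
  finally show ?thesis .
qed

lemma deriv_r:
  assumes "t \<in> I"
  shows "(r0 has_real_derivative - h t * b t ^ 5) (at t)"
    and "(r2 has_real_derivative - 2 * f1 t * b t ^ 5 / 3) (at t)"
  unfolding coeff_defs[abs_def]
  by (auto intro!: derivative_eq_intros coeff_derivs[OF assms] simp: field_simps eval_nat_numeral)

text \<open>In the derivative of \<open>z0\<close> every term with \<open>G\<close> cancels; the two
  summands of the \<open>K\<close> integrand that contain \<open>G\<close>, and the term
  \<open>(G t)\<^sup>2 * f1 t / 54\<close>, are made for this.\<close>

lemma deriv_z:
  assumes "t \<in> I"
  shows "(z0 has_real_derivative (h t)\<^sup>2 * b t ^ 7 / 2 - g t * b t ^ 4) (at t)"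
    and "(z2 has_real_derivative - h1 t * b t ^ 4 / 2 + 2 * h t * f1 t * b t ^ 7 / 3) (at t)"
    and "(z3 has_real_derivative - f2 t * b t ^ 4 / 6 + 2 * (f1 t)\<^sup>2 * b t ^ 7 / 9) (at t)"
  unfolding coeff_defs[abs_def]
  by (auto intro!: derivative_eq_intros coeff_derivs[OF assms] simp: field_simps eval_nat_numeral)

lemma deriv_w:
  assumes "t \<in> I"
  shows "(w0 has_real_derivative g1 t * b t - g t * f1 t * b t ^ 4 / 3 - h t * h1 t * b t ^ 4 / 2
      + (h t)\<^sup>2 * f1 t * b t ^ 7 / 3) (at t)"
    and "(w1 has_real_derivative f2 t * b t / 3 - (f1 t)\<^sup>2 * b t ^ 4 / 9) (at t)"
    and "(w2 has_real_derivative h2 t * b t / 2 - h1 t * f1 t * b t ^ 4 / 2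
      - h t * f2 t * b t ^ 4 / 3 + 4 * h t * (f1 t)\<^sup>2 * b t ^ 7 / 9) (at t)"
    and "(w3 has_real_derivative f3 t * b t / 6 - 5 * f1 t * f2 t * b t ^ 4 / 18
      + 4 * f1 t ^ 3 * b t ^ 7 / 27) (at t)"
  unfolding coeff_defs[abs_def]
  by (auto intro!: derivative_eq_intros coeff_derivs[OF assms] simp: field_simps eval_nat_numeral)

lemma deriv_w4:
  assumes "t \<in> I"
  shows "(w4 has_real_derivative 2 * f1 t * b t / 3) (at t)"
  unfolding coeff_defs[abs_def]
  by (auto intro!: derivative_eq_intros coeff_derivs[OF assms] simp: b_def a_nonzero[OF assms] field_simps eval_nat_numeral)

text \<open>The partial derivatives in \<open>t\<close>, free of \<open>G\<close> and
  \<open>K\<close>, so that what follows involves only \<open>b\<close> and the derivatives of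
  \<open>f\<close>, \<open>g\<close>, \<open>h\<close>.\<close>

definition "r_t t y = - h t * b t ^ 5 - 2 * f1 t * b t ^ 5 / 3 * y"

definition "z_t t x y = (h t)\<^sup>2 * b t ^ 7 / 2 - g t * b t ^ 4 - f1 t * b t ^ 4 / 3 * x
  + (- h1 t * b t ^ 4 / 2 + 2 * h t * f1 t * b t ^ 7 / 3) * y
  + (- f2 t * b t ^ 4 / 6 + 2 * (f1 t)\<^sup>2 * b t ^ 7 / 9) * y\<^sup>2"

definition "w_t t x y u = g1 t * b t - g t * f1 t * b t ^ 4 / 3 - h t * h1 t * b t ^ 4 / 2
      + (h t)\<^sup>2 * f1 t * b t ^ 7 / 3
  + (f2 t * b t / 3 - (f1 t)\<^sup>2 * b t ^ 4 / 9) * x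
  + (h2 t * b t / 2 - h1 t * f1 t * b t ^ 4 / 2 - h t * f2 t * b t ^ 4 / 3
      + 4 * h t * (f1 t)\<^sup>2 * b t ^ 7 / 9) * y
  + (f3 t * b t / 6 - 5 * f1 t * f2 t * b t ^ 4 / 18 + 4 * f1 t ^ 3 * b t ^ 7 / 27) * y\<^sup>2
  + 2 * f1 t * b t / 3 * u"

section \<open>Differentials of the three invariants\<close>

abbreviation "R \<equiv> \<lambda>(t, x, y, u :: real). inv_r f G t x y"
abbreviation "Z \<equiv> \<lambda>(t, x, y, u :: real). inv_z f (\<lambda>t. 3 * h t) G K t x y"
abbreviation "W \<equiv> \<lambda>(t, x, y, u). inv_w f (\<lambda>t. 6 * g t) (\<lambda>t. 3 * h t) t x y u"
abbreviation "V \<equiv> \<lambda>p. field_x g p + field_y h p + field_z f p"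

text \<open>The polynomial forms hold only for times in \<open>I\<close>; as
  \<open>I \<times> UNIV\<close> is open, they still determine the derivative there.\<close>

lemma has_derivative_on_domain:
  assumes "(F has_derivative F') (at (t, x, y, u))" "t \<in> I"
    and "\<And>t x y u. t \<in> I \<Longrightarrow> F (t, x, y, u) = H (t, x, y, u)"
  shows "(H has_derivative F') (at (t, x, y, u))"
proof (rule has_derivative_transform_within_open[OF assms(1)])
  show "open (I \<times> UNIV)" by (simp add: open_I open_Times)
qed (use assms in auto)

lemma R_deriv:
  fixes t x y u :: real
  assumes "t \<in> I"
  shows "(R has_derivative (\<lambda>(dt, dx, dy, du). r_t t y * dt + r2 t * dy)) (at (t, x, y, u))"
proof -
  have zero: "((\<lambda>_. 0) has_real_derivative 0) (at t)" by simp
  show ?thesis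
    by (rule has_derivative_on_domain[OF has_derivative_eq_rhs[OF has_derivative_quadratic_coeffs
          [OF deriv_r(1)[OF assms] zero deriv_r(2)[OF assms] zero zero]] assms])
      (auto simp: inv_r_eq r_t_def fun_eq_iff)
qed

lemma Z_deriv:
  fixes t x y u :: real
  assumes "t \<in> I"
  shows "(Z has_derivative (\<lambda>(dt, dx, dy, du). z_t t x y * dt + b t * dx + (z2 t + 2 * z3 t * y) * dy))
    (at (t, x, y, u))"
proof -
  have zero: "((\<lambda>_. 0) has_real_derivative 0) (at t)" by simp
  show ?thesis
    by (rule has_derivative_on_domain[OF has_derivative_eq_rhs[OF has_derivative_quadratic_coeffs
          [OF deriv_z(1)[OF assms] deriv_b[OF assms] deriv_z(2,3)[OF assms] zero]] assms])
      (auto simp: inv_z_eq z_t_def fun_eq_iff)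
qed

lemma W_deriv:
  fixes t x y u :: real
  assumes "t \<in> I"
  shows "(W has_derivative (\<lambda>(dt, dx, dy, du). w_t t x y u * dt + w1 t * dx + (w2 t + 2 * w3 t * y) * dy
      + w4 t * du)) (at (t, x, y, u))"
  by (rule has_derivative_on_domain[OF has_derivative_eq_rhs[OF has_derivative_quadratic_coeffs
        [OF deriv_w(1-4)[OF assms] deriv_w4[OF assms]]] assms])
    (auto simp: inv_w_eq w_t_def fun_eq_iff)

lemmas frechet_RZW =
  frechet_derivative_at[OF R_deriv, symmetric]
  frechet_derivative_at[OF Z_deriv, symmetric]
  frechet_derivative_at[OF W_deriv, symmetric]

section \<open>Annihilation by the field and independence of the differentials\<close>

definition "v_x t x y = g t + y * h1 t / 2 + (2 * x * f1 t + y\<^sup>2 * f2 t) / 6"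
definition "v_y t y = h t + 2 * y * f1 t / 3"
definition "v_u t x y u = - g1 t - y * h2 t / 2 - (4 * u * f1 t + 2 * x * f2 t + y\<^sup>2 * f3 t) / 6"

lemma V_eq: "V (t, x, y, u) = (f t, v_x t x y, v_y t y, v_u t x y u)"
  by (simp add: field_x_def field_y_def field_z_def v_x_def v_y_def v_u_def field_simps)

text \<open>With \<open>f t = a t ^ 3\<close> and \<open>b t = inverse (a t)\<close> these are
  rational identities in \<open>a t\<close>, in which the values of \<open>g\<close>,
  \<open>h\<close> and of all derivatives are free symbols.\<close>

lemma annihilation:
  assumes "t \<in> I"
  shows "r_t t y * f t + r2 t * v_y t y = 0"
    and "z_t t x y * f t + b t * v_x t x y + (z2 t + 2 * z3 t * y) * v_y t y = 0"
    and "w_t t x y u * f t + w1 t * v_x t x y + (w2 t + 2 * w3 t * y) * v_y t y + w4 t * v_u t x y u = 0"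
  using a_nonzero[OF assms]
  unfolding r_t_def z_t_def w_t_def v_x_def v_y_def v_u_def coeff_defs b_def f_eq[of t]
  by (simp_all add: field_simps eval_nat_numeral)

lemma invariant_RZW:
  "invariant_on (I \<times> UNIV) V R" "invariant_on (I \<times> UNIV) V Z" "invariant_on (I \<times> UNIV) V W"
proof -
  have "invariant_on (I \<times> UNIV) V F"
    if "\<And>t x y u. t \<in> I \<Longrightarrow> (F has_derivative F' t x y u) (at (t, x, y, u))"
      and "\<And>t x y u. t \<in> I \<Longrightarrow> F' t x y u (V (t, x, y, u)) = 0" for F F'
    unfolding invariant_on_def
  proof
    fix p :: point
    assume "p \<in> I \<times> UNIV"
    then obtain t x y u where p: "p = (t, x, y, u)" "t \<in> I" by (cases p) auto
    show "F differentiable (at p) \<and> frechet_derivative F (at p) (V p) = 0"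
      using that[OF p(2)] frechet_derivative_at[OF that(1)[OF p(2)], symmetric] unfolding p(1)
      by (metis differentiableI)
  qed
  note * = this
  show "invariant_on (I \<times> UNIV) V R"
    by (rule *[OF R_deriv]) (simp_all only: V_eq annihilation split)
  show "invariant_on (I \<times> UNIV) V Z"
    by (rule *[OF Z_deriv]) (simp_all only: V_eq annihilation split)
  show "invariant_on (I \<times> UNIV) V W"
    by (rule *[OF W_deriv]) (simp_all only: V_eq annihilation split)
qed

lemma independent_RZW:
  assumes "t \<in> I"
    and "\<And>d. \<alpha> * frechet_derivative R (at (t, x, y, u)) d + \<beta> * frechet_derivative Z (at (t, x, y, u)) d
      + \<gamma> * frechet_derivative W (at (t, x, y, u)) d = 0"
  shows "\<alpha> = 0 \<and> \<beta> = 0 \<and> \<gamma> = 0"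
proof -
  have nz: "b t \<noteq> 0" "r2 t \<noteq> 0" "w4 t \<noteq> 0"
    using a_nonzero[OF assms(1)] by (simp_all add: b_def coeff_defs)
  note eq = assms(2)[unfolded frechet_RZW[OF assms(1)]]
  \<comment> \<open>Only the third invariant involves \<open>u\<close>, and the first does not
    involve \<open>x\<close>; testing the directions \<open>u\<close>, \<open>x\<close>,
    \<open>y\<close> in this order isolates one coefficient at a time.\<close>
  have "\<gamma> = 0" using eq[of "(0, 0, 0, 1)"] nz by simp
  moreover have "\<beta> = 0" using eq[of "(0, 1, 0, 0)"] nz \<open>\<gamma> = 0\<close> by simp
  moreover have "\<alpha> = 0" using eq[of "(0, 0, 1, 0)"] nz \<open>\<gamma> = 0\<close> \<open>\<beta> = 0\<close> by simp
  ultimately show ?thesis by simp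
qed

section \<open>Level curves, and constancy of every invariant along them\<close>

definition "Y_of r t = (r - r0 t) * (a t)\<^sup>2"
definition "X_of r z t = (z - z0 t - z2 t * Y_of r t - z3 t * (Y_of r t)\<^sup>2) * a t"
definition "U_of r z w t = (w - w0 t - w1 t * X_of r z t - w2 t * Y_of r t - w3 t * (Y_of r t)\<^sup>2) * (b t)\<^sup>2"
text \<open>The common level set of the three invariants, parametrised by time. Its components
  invert the triangular coordinate change in the order \<open>y\<close>, \<open>x\<close>,
  \<open>u\<close>.\<close>

definition "curve r z w t = (t, X_of r z t, Y_of r t, U_of r z w t)"

lemma curve_invariants:
  assumes "t \<in> I"
  shows "R (curve r z w t) = r" "Z (curve r z w t) = z" "W (curve r z w t) = w"
proof -
  have "r2 t * Y_of r t = ((a t)\<^sup>2 * (b t)\<^sup>2) * (r - r0 t)"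
    by (simp add: Y_of_def r2_def)
  thus "R (curve r z w t) = r"
    unfolding a_b_powers[OF assms] by (simp add: curve_def inv_r_eq assms)
  have "b t * X_of r z t = (a t * b t) * (z - z0 t - z2 t * Y_of r t - z3 t * (Y_of r t)\<^sup>2)"
    by (simp add: X_of_def)
  thus "Z (curve r z w t) = z"
    unfolding ab[OF assms] by (simp add: curve_def inv_z_eq assms)
  have "w4 t * U_of r z w t
      = ((a t)\<^sup>2 * (b t)\<^sup>2) * (w - w0 t - w1 t * X_of r z t - w2 t * Y_of r t - w3 t * (Y_of r t)\<^sup>2)"
    by (simp add: U_of_def w4_def)
  thus "W (curve r z w t) = w"
    unfolding a_b_powers[OF assms] by (simp add: curve_def inv_w_eq assms)
qed

lemma invariants_inj:
  assumes "t \<in> I" "R (t, x, y, u) = R (t, x', y', u')" "Z (t, x, y, u) = Z (t, x', y', u')"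
    "W (t, x, y, u) = W (t, x', y', u')"
  shows "(t, x, y, u) = (t, x', y', u')"
  using assms a_nonzero[OF assms(1)] by (auto simp: inv_r_eq inv_z_eq inv_w_eq r2_def w4_def b_def)

text \<open>The derivatives stay anonymous here; their values are recovered later from the constancy
  of the invariants along the curve.\<close>

lemma curve_differentiable:
  assumes "t \<in> I"
  obtains X' Y' U' where "(X_of r z has_real_derivative X') (at t)"
    "(Y_of r has_real_derivative Y') (at t)" "(U_of r z w has_real_derivative U') (at t)"
proof -
  note d = deriv_r[OF assms] deriv_z[OF assms] deriv_w[OF assms] deriv_w4[OF assms]
    deriv_a[OF assms] deriv_b[OF assms]
  have "\<exists>Y'. (Y_of r has_real_derivative Y') (at t)"
    unfolding Y_of_def[abs_def] by (rule exI, (rule d derivative_intros)+)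
  then obtain Y' where Y: "(Y_of r has_real_derivative Y') (at t)" ..
  have "\<exists>X'. (X_of r z has_real_derivative X') (at t)"
    unfolding X_of_def[abs_def] by (rule exI, (rule d Y derivative_intros)+)
  then obtain X' where X: "(X_of r z has_real_derivative X') (at t)" ..
  have "\<exists>U'. (U_of r z w has_real_derivative U') (at t)"
    unfolding U_of_def[abs_def] by (rule exI, (rule d X Y derivative_intros)+)
  then obtain U' where U: "(U_of r z w has_real_derivative U') (at t)" ..
  show thesis by (rule that[OF X Y U])
qed

lemma derivative_zero_along_curve:
  assumes "t \<in> I" "(c has_derivative c') (at t)" "(F has_derivative F') (at (c t))"
    and "\<And>s. s \<in> I \<Longrightarrow> F (c s) = k"
  shows "F' (c' 1) = 0"
proof -
  have "((\<lambda>s. F (c s)) has_derivative (\<lambda>d. F' (c' d))) (at t)"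
    by (rule has_derivative_compose[OF assms(2,3)])
  hence "((\<lambda>s. k) has_derivative (\<lambda>d. F' (c' d))) (at t)"
    by (rule has_derivative_transform_within_open[OF _ open_I assms(1,4)])
  hence "(\<lambda>d. F' (c' d)) = (\<lambda>d. 0)"
    using has_derivative_unique has_derivative_const by blast
  thus ?thesis by meson
qed

text \<open>\<open>f\<close> times the velocity of \<open>curve r z w\<close> is \<open>V\<close>, because \<open>R\<close>, \<open>Z\<close>, \<open>W\<close> annihilate both.\<close>

lemma invariant_deriv_along_curve:
  assumes "t \<in> I" "invariant_on (I \<times> UNIV) V F"
  shows "((\<lambda>t. F (curve r z w t)) has_real_derivative 0) (at t)"
proof -
  obtain X' Y' U' where d: "(X_of r z has_real_derivative X') (at t)"
    "(Y_of r has_real_derivative Y') (at t)" "(U_of r z w has_real_derivative U') (at t)"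
    by (rule curve_differentiable[OF assms(1)])
  define x y u where "x = X_of r z t" "y = Y_of r t" "u = U_of r z w t"
  have c: "curve r z w t = (t, x, y, u)" by (simp add: curve_def x_y_u_def)
  have cd: "(curve r z w has_derivative (\<lambda>d. (d, X' * d, Y' * d, U' * d))) (at t)"
    unfolding curve_def[abs_def]
    by (intro has_derivative_Pair has_derivative_ident d[unfolded has_field_derivative_def])
  have R0: "r_t t y + r2 t * Y' = 0"
    using derivative_zero_along_curve[where F = R and c = "curve r z w" and k = r,
        OF assms(1) cd R_deriv[OF assms(1), where x = x and y = y and u = u, folded c]]
      curve_invariants(1)[of _ r z w]
    by simp
  have Z0: "z_t t x y + b t * X' + (z2 t + 2 * z3 t * y) * Y' = 0"
    using derivative_zero_along_curve[where F = Z and c = "curve r z w" and k = z,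
        OF assms(1) cd Z_deriv[OF assms(1), where x = x and y = y and u = u, folded c]]
      curve_invariants(2)[of _ r z w]
    by simp
  have W0: "w_t t x y u + w1 t * X' + (w2 t + 2 * w3 t * y) * Y' + w4 t * U' = 0"
    using derivative_zero_along_curve[where F = W and c = "curve r z w" and k = w,
        OF assms(1) cd W_deriv[OF assms(1), where x = x and y = y and u = u, folded c]]
      curve_invariants(3)[of _ r z w]
    by simp
  have nz: "b t \<noteq> 0" "r2 t \<noteq> 0" "w4 t \<noteq> 0"
    using a_nonzero[OF assms(1)] by (simp_all add: b_def coeff_defs)
  let ?zy = "z2 t + 2 * z3 t * y" and ?wy = "w2 t + 2 * w3 t * y"
  \<comment> \<open>Subtracting the annihilation identity from \<open>f t\<close> times the
    constancy relation leaves a nonzero leading coefficient times the discrepancy. The triangular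
    shape allows this for \<open>Y'\<close>, then \<open>X'\<close>, then \<open>U'\<close>.\<close>
  have "r2 t * (f t * Y' - v_y t y)
      = f t * (r_t t y + r2 t * Y') - (r_t t y * f t + r2 t * v_y t y)"
    by (simp add: algebra_simps)
  hence Y: "f t * Y' = v_y t y"
    unfolding R0 annihilation(1)[OF assms(1)] using nz by simp
  have "b t * (f t * X' - v_x t x y)
      = f t * (z_t t x y + b t * X' + ?zy * Y') - (z_t t x y * f t + b t * v_x t x y + ?zy * v_y t y)
        - ?zy * (f t * Y' - v_y t y)"
    by (simp add: algebra_simps)
  hence X: "f t * X' = v_x t x y"
    unfolding Z0 annihilation(2)[OF assms(1)] Y using nz by simp
  have "w4 t * (f t * U' - v_u t x y u)
      = f t * (w_t t x y u + w1 t * X' + ?wy * Y' + w4 t * U')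
        - (w_t t x y u * f t + w1 t * v_x t x y + ?wy * v_y t y + w4 t * v_u t x y u)
        - w1 t * (f t * X' - v_x t x y) - ?wy * (f t * Y' - v_y t y)"
    by (simp add: algebra_simps)
  hence U: "f t * U' = v_u t x y u"
    unfolding W0 annihilation(3)[OF assms(1)] X Y using nz by simp
  let ?F = "frechet_derivative F (at (t, x, y, u))"
  have inv: "F differentiable (at (t, x, y, u))" "?F (V (t, x, y, u)) = 0"
    using assms unfolding invariant_on_def by blast+
  have F: "(F has_derivative ?F) (at (curve r z w t))"
    using inv(1) frechet_derivative_works unfolding c by blast
  have "f t *\<^sub>R (1, X', Y', U') = V (t, x, y, u)" unfolding V_eq using X Y U by simp
  hence "f t * ?F (1, X', Y', U') = 0"
    using linear_scale[OF has_derivative_linear[OF F], of "f t" "(1, X', Y', U')"] inv(2) by simp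
  hence "?F (1, X', Y', U') = 0" using f_nonzero[OF assms(1)] by simp
  hence "?F (d, X' * d, Y' * d, U' * d) = 0" for d
    using linear_scale[OF has_derivative_linear[OF F], of d "(1, X', Y', U')"] by (simp add: mult.commute)
  thus ?thesis
    using has_derivative_compose[OF cd F] unfolding has_field_derivative_def by (simp add: lambda_zero)
qed

lemma complete_RZW:
  "complete_invariants (I \<times> UNIV) V R Z W"
  unfolding complete_invariants_def
proof (intro conjI invariant_RZW ballI allI impI)
  fix p :: point and \<alpha> \<beta> \<gamma>
  assume p: "p \<in> I \<times> UNIV" and lin: "\<forall>d. \<alpha> * frechet_derivative R (at p) d
    + \<beta> * frechet_derivative Z (at p) d + \<gamma> * frechet_derivative W (at p) d = 0"
  obtain t x y u where "p = (t, x, y, u)" by (cases p)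
  with p lin independent_RZW[of t \<alpha> x y u \<beta> \<gamma>] show "\<alpha> = 0" "\<beta> = 0" "\<gamma> = 0" by blast+
next
  fix F
  assume F: "invariant_on (I \<times> UNIV) V F"
  obtain t0 where t0: "t0 \<in> I" using nonempty_I by blast
  have "convex I" using connected_I is_interval_connected_1 is_interval_convex_1 by blast
  have "F (curve r z w s) = F (curve r z w t0)" if "s \<in> I" for r z w s
    using has_field_derivative_zero_constant[OF \<open>convex I\<close>, of "\<lambda>t. F (curve r z w t)"]
      invariant_deriv_along_curve[OF _ F] that t0 has_field_derivative_at_within by metis
  \<comment> \<open>Each point lies on the level curve labelled by its own invariants, at its own
    time.\<close>
  moreover have "p = curve (R p) (Z p) (W p) (fst p)" if "p \<in> I \<times> UNIV" for p
  proof -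
    obtain t x y u where p: "p = (t, x, y, u)" by (cases p)
    with that have "t \<in> I" by simp
    show ?thesis
      using invariants_inj[OF \<open>t \<in> I\<close>, of x y u "X_of (R p) (Z p) t" "Y_of (R p) t" "U_of (R p) (Z p) (W p) t"]
        curve_invariants[OF \<open>t \<in> I\<close>, of "R p" "Z p" "W p"]
      unfolding p curve_def by simp
  qed
  ultimately have "F p = F (curve (R p) (Z p) (W p) t0)" if "p \<in> I \<times> UNIV" for p
    using that by (metis mem_Times_iff)
  thus "\<exists>\<Phi>. \<forall>p\<in>I \<times> UNIV. F p = \<Phi> (R p) (Z p) (W p)"
    \<comment> \<open>The function is read off by sliding along the level curve to the fixed time
      \<open>t0\<close>.\<close>
    by (intro exI[of _ "\<lambda>r z w. F (curve r z w t0)"]) blast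
qed

subsection \<open>Reduction\<close>

abbreviation "\<rho> \<equiv> inv_r f G"
abbreviation "\<zeta> \<equiv> inv_z f (\<lambda>t. 3 * h t) G K"
abbreviation "\<omega> \<equiv> inv_w f (\<lambda>t. 6 * g t) (\<lambda>t. 3 * h t)"

lemma \<rho>_\<zeta>_partials:
  assumes "t \<in> I"
  shows "((\<lambda>t. \<rho> t x y) has_real_derivative r_t t y) (at t)"
    "((\<lambda>x. \<rho> t x y) has_real_derivative 0) (at x)"
    "((\<lambda>y. \<rho> t x y) has_real_derivative r2 t) (at y)"
    "((\<lambda>t. \<zeta> t x y) has_real_derivative z_t t x y) (at t)"
    "((\<lambda>x. \<zeta> t x y) has_real_derivative b t) (at x)"
    "((\<lambda>y. \<zeta> t x y) has_real_derivative z2 t + 2 * z3 t * y) (at y)"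
proof -
  \<comment> \<open>\<open>R\<close> and \<open>Z\<close> do not depend on \<open>u\<close>, so the
    value 0 is a placeholder.\<close>
  have lines: "((\<lambda>s. (s, x, y, 0::real)) has_derivative (\<lambda>d. d *\<^sub>R (1, 0, 0, 0))) (at t)"
    "((\<lambda>s. (t, s, y, 0::real)) has_derivative (\<lambda>d. d *\<^sub>R (0, 1, 0, 0))) (at x)"
    "((\<lambda>s. (t, x, s, 0::real)) has_derivative (\<lambda>d. d *\<^sub>R (0, 0, 1, 0))) (at y)"
    by (auto intro!: derivative_eq_intros simp: zero_prod_def)
  show "((\<lambda>t. \<rho> t x y) has_real_derivative r_t t y) (at t)"
    "((\<lambda>x. \<rho> t x y) has_real_derivative 0) (at x)"
    "((\<lambda>y. \<rho> t x y) has_real_derivative r2 t) (at y)"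
    using has_real_derivative_along_line[where H = R and c = "\<lambda>s. (s, x, y, 0)" and t = t, OF R_deriv[OF assms] lines(1)]
          has_real_derivative_along_line[where H = R and c = "\<lambda>s. (t, s, y, 0)" and t = x, OF R_deriv[OF assms] lines(2)]
          has_real_derivative_along_line[where H = R and c = "\<lambda>s. (t, x, s, 0)" and t = y, OF R_deriv[OF assms] lines(3)]
    by simp_all
  show "((\<lambda>t. \<zeta> t x y) has_real_derivative z_t t x y) (at t)"
    "((\<lambda>x. \<zeta> t x y) has_real_derivative b t) (at x)"
    "((\<lambda>y. \<zeta> t x y) has_real_derivative z2 t + 2 * z3 t * y) (at y)"
    using has_real_derivative_along_line[where H = Z and c = "\<lambda>s. (s, x, y, 0)" and t = t, OF Z_deriv[OF assms] lines(1)]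
          has_real_derivative_along_line[where H = Z and c = "\<lambda>s. (t, s, y, 0)" and t = x, OF Z_deriv[OF assms] lines(2)]
          has_real_derivative_along_line[where H = Z and c = "\<lambda>s. (t, x, s, 0)" and t = y, OF Z_deriv[OF assms] lines(3)]
    by simp_all
qed

text \<open>The set \<open>P\<close> of \<open>reduces_to\<close>, named so that it can be folded
  there.\<close>

definition "preimage D = {(t, x, y). t \<in> I \<and> (\<rho> t x y, \<zeta> t x y) \<in> D}"

lemma open_preimage:
  assumes "open D"
  shows "open (preimage D)"
proof -
  have "isCont R p \<and> isCont Z p" if "p \<in> I \<times> UNIV" for p :: point
  proof -
    obtain t x y u where p: "p = (t, x, y, u)" by (cases p)
    with that have "t \<in> I" by simp
    show ?thesis
      unfolding p
      by (intro conjI has_derivative_continuous[OF R_deriv[OF \<open>t \<in> I\<close>]]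
          has_derivative_continuous[OF Z_deriv[OF \<open>t \<in> I\<close>]])
  qed
  hence "continuous_on (I \<times> UNIV) R" "continuous_on (I \<times> UNIV) Z"
    by (intro continuous_at_imp_continuous_on ballI; blast)+
  moreover have "continuous_on (I \<times> UNIV) (\<lambda>(t, x, y). H (t, x, y, 0))"
    if "continuous_on (I \<times> UNIV) H" for H :: "point \<Rightarrow> real"
    unfolding case_prod_beta
    by (rule continuous_on_compose2[OF that]) (auto intro!: continuous_intros)
  ultimately have "continuous_on (I \<times> UNIV) (\<lambda>(t, x, y). R (t, x, y, 0))"
    "continuous_on (I \<times> UNIV) (\<lambda>(t, x, y). Z (t, x, y, 0))"
    by blast+
  from continuous_on_Pair[OF this]
  have "open ((I \<times> UNIV) \<inter> (\<lambda>p. (case p of (t, x, y) \<Rightarrow> R (t, x, y, 0), case p of (t, x, y) \<Rightarrow> Z (t, x, y, 0))) -` D)"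
    by (rule continuous_open_preimage[OF _ open_Times[OF open_I open_UNIV] assms])
  also have "\<dots> = preimage D" by (auto simp: preimage_def)
  finally show ?thesis .
qed

text \<open>A single time suffices: at fixed \<open>t\<close> the equations are solved for
  \<open>y\<close>, then \<open>x\<close>.\<close>

lemma preimage_surj:
  assumes "(r, z) \<in> D"
  obtains t x y where "(t, x, y) \<in> preimage D" "\<rho> t x y = r" "\<zeta> t x y = z"
proof -
  obtain t where t: "t \<in> I" using nonempty_I by blast
  show thesis
    by (rule that[of t "X_of r z t" "Y_of r t"])
      (use curve_invariants[OF t, of r z 0] t assms in \<open>auto simp: curve_def preimage_def\<close>)
qed

section \<open>Solving the ansatz for \<open>u\<close> and substituting it into the ZK
  expression\<close>

lemma inv_w_solve:
  assumes "t \<in> I"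
  shows "\<omega> t x y \<upsilon> = c \<longleftrightarrow> \<upsilon> = (c - w0 t - w1 t * x - w2 t * y - w3 t * y\<^sup>2) * (b t)\<^sup>2"
proof -
  have "\<upsilon> = c' * (b t)\<^sup>2 \<longleftrightarrow> (a t)\<^sup>2 * \<upsilon> = c'" for c'
    using a_nonzero[OF assms] by (auto simp: b_def field_simps)
  moreover have "\<omega> t x y \<upsilon> = c \<longleftrightarrow> (a t)\<^sup>2 * \<upsilon> = c - w0 t - w1 t * x - w2 t * y - w3 t * y\<^sup>2"
    unfolding inv_w_eq[OF assms] w4_def by (rule iffI) linarith+
  ultimately show ?thesis by blast
qed

text \<open>The mixed terms \<open>p12\<close> of \<open>u_xt\<close> and \<open>u_yy\<close>
  cancel, as do the terms linear in \<open>p2\<close> and those without \<open>w\<close>. The factor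
  of \<open>p22\<close> collapses to \<open>- (b t ^ 6)\<close> times \<open>w\<close>, while
  \<open>p2\<^sup>2\<close> and \<open>p11\<close> each carry \<open>- (b t ^ 6)\<close>.\<close>

lemma zk_lhs_eq:
  assumes D: "open D"
    and w: "\<And>p. p \<in> D \<Longrightarrow> has_partials (\<lambda>(r, z). w r z) (p1 p) (p2 p) p"
    and p1: "\<And>p. p \<in> D \<Longrightarrow> has_partials p1 (p11 p) (p12 p) p"
    and p2: "\<And>p. p \<in> D \<Longrightarrow> has_partials p2 (p12 p) (p22 p) p"
    and u: "\<And>t x y. (t, x, y) \<in> preimage D \<Longrightarrow> \<omega> t x y (u t x y) = w (\<rho> t x y) (\<zeta> t x y)"
    and mem: "(t, x, y) \<in> preimage D"
  shows "zk_lhs u t x y = - (b t ^ 6) * reduced_lhs w (\<rho> t x y) (\<zeta> t x y)"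
proof -
  let ?q = "\<lambda>t x y. (\<rho> t x y, \<zeta> t x y)"
  note slice = deriv_eq_on_open_slice[OF open_preimage[OF D]]
  have in_I: "t \<in> I" and in_D: "?q t x y \<in> D" if "(t, x, y) \<in> preimage D" for t x y
    using that by (auto simp: preimage_def)
  have chain: "((\<lambda>t. F (?q t x y)) has_real_derivative A * r_t t y + B * z_t t x y) (at t)"
    "((\<lambda>x. F (?q t x y)) has_real_derivative B * b t) (at x)"
    "((\<lambda>y. F (?q t x y)) has_real_derivative A * r2 t + B * (z2 t + 2 * z3 t * y)) (at y)"
    if "has_partials F A B (?q t x y)" "t \<in> I" for F A B t x y
    using has_partials_chain[OF that(1) \<rho>_\<zeta>_partials(1,4)[OF that(2)]]
      has_partials_chain[OF that(1) \<rho>_\<zeta>_partials(2,5)[OF that(2)]]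
      has_partials_chain[OF that(1) \<rho>_\<zeta>_partials(3,6)[OF that(2)]] by simp_all
  have u_eq: "u t x y = (w (\<rho> t x y) (\<zeta> t x y) - w0 t - w1 t * x - w2 t * y - w3 t * y\<^sup>2) * (b t)\<^sup>2"
    if "(t, x, y) \<in> preimage D" for t x y
    using u[OF that] inv_w_solve[OF in_I[OF that]] by blast
  have x_slice: "continuous_on UNIV (\<lambda>x. (t, x, y))" and y_slice: "continuous_on UNIV (\<lambda>y. (t, x, y))"
    and t_slice: "continuous_on UNIV (\<lambda>t. (t, x, y))" for t x y :: real
    by (intro continuous_intros)+
  have dw: "((\<lambda>x. w (\<rho> t x y) (\<zeta> t x y)) has_real_derivative p2 (?q t x y) * b t) (at x)"
    "((\<lambda>y. w (\<rho> t x y) (\<zeta> t x y)) has_real_derivative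
       p1 (?q t x y) * r2 t + p2 (?q t x y) * (z2 t + 2 * z3 t * y)) (at y)"
    if "(t, x, y) \<in> preimage D" for t x y
    using chain(2,3)[OF w[OF in_D[OF that]] in_I[OF that]] by simp_all
  \<comment> \<open>The first derivatives are established on the whole preimage, not just at the
    given point, so that they can be differentiated again.\<close>
  have u_x: "deriv (\<lambda>x. u t x y) x = (p2 (?q t x y) * b t - w1 t) * (b t)\<^sup>2"
    if "(t, x, y) \<in> preimage D" for t x y
    by (rule slice[OF x_slice that u_eq]) (auto intro!: derivative_eq_intros dw that)
  have u_y: "deriv (\<lambda>y. u t x y) y = (p1 (?q t x y) * r2 t + p2 (?q t x y) * (z2 t + 2 * z3 t * y)
      - w2 t - 2 * w3 t * y) * (b t)\<^sup>2"
    if "(t, x, y) \<in> preimage D" for t x y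
    by (rule slice[OF y_slice that u_eq]) (auto intro!: derivative_eq_intros dw that)
  note q = in_D[OF mem] and t = in_I[OF mem]
  let ?p1 = "p1 (?q t x y)" and ?p2 = "p2 (?q t x y)"
    and ?p11 = "p11 (?q t x y)" and ?p12 = "p12 (?q t x y)" and ?p22 = "p22 (?q t x y)"
  note dpart = chain(1)[OF p2[OF q] t] chain(2)[OF p2[OF q] t] chain(3)[OF p1[OF q] t] chain(3)[OF p2[OF q] t]
  have u_xt: "deriv (\<lambda>t. deriv (\<lambda>x. u t x y) x) t
      = ((?p12 * r_t t y + ?p22 * z_t t x y) * b t + ?p2 * (- f1 t * b t ^ 4 / 3)
          - (f2 t * b t / 3 - (f1 t)\<^sup>2 * b t ^ 4 / 9)) * (b t)\<^sup>2
        + (?p2 * b t - w1 t) * (2 * b t * (- f1 t * b t ^ 4 / 3))"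
    by (rule slice[OF t_slice mem u_x], assumption)
      (rule DERIV_cong, (rule dpart(1) deriv_b[OF t] deriv_w(2)[OF t] derivative_intros)+,
        simp add: algebra_simps)
  \<comment> \<open>The product rule in the form \<open>u_x\<^sup>2 + u * u_xx\<close>, with
    \<open>u_xx\<close> equal to \<open>?p22 * b t ^ 4\<close>.\<close>
  have "((\<lambda>x. (w (\<rho> t x y) (\<zeta> t x y) - w0 t - w1 t * x - w2 t * y - w3 t * y\<^sup>2) * (b t)\<^sup>2
        * ((p2 (?q t x y) * b t - w1 t) * (b t)\<^sup>2)) has_real_derivative
      ((?p2 * b t - w1 t) * (b t)\<^sup>2)\<^sup>2 + u t x y * (?p22 * b t ^ 4)) (at x)"
    unfolding u_eq[OF mem]
    by (rule DERIV_cong, (rule dw(1)[OF mem] dpart(2) derivative_intros)+)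
      (simp add: algebra_simps eval_nat_numeral)
  hence u_ux: "deriv (\<lambda>x. u t x y * deriv (\<lambda>x. u t x y) x) x
      = ((?p2 * b t - w1 t) * (b t)\<^sup>2)\<^sup>2 + u t x y * (?p22 * b t ^ 4)"
    by (rule slice[OF x_slice mem, rotated]) (simp only: u_eq u_x)
  have u_yy: "deriv (\<lambda>y. deriv (\<lambda>y. u t x y) y) y
      = ((?p11 * r2 t + ?p12 * (z2 t + 2 * z3 t * y)) * r2 t
          + (?p12 * r2 t + ?p22 * (z2 t + 2 * z3 t * y)) * (z2 t + 2 * z3 t * y)
          + ?p2 * (2 * z3 t) - 2 * w3 t) * (b t)\<^sup>2"
    by (rule slice[OF y_slice mem u_y], assumption)
      (rule DERIV_cong, (rule dpart(3,4) derivative_intros)+, simp add: algebra_simps)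
  have red: "reduced_lhs w (\<rho> t x y) (\<zeta> t x y) = ?p2\<^sup>2 + w (\<rho> t x y) (\<zeta> t x y) * ?p22 + ?p11"
    by (rule reduced_lhs_eq[OF D w p1 p2 q])
  show ?thesis
    unfolding zk_lhs_def u_xt u_ux u_yy u_eq[OF mem] red r_t_def z_t_def coeff_defs
    by (simp add: field_simps eval_nat_numeral)
qed

lemma reduction_zk: "reduces_to I zk_lhs \<rho> \<zeta> \<omega> reduced_lhs"
  unfolding reduces_to_def Let_def preimage_def[symmetric]
proof (intro allI impI conjI)
  fix D and w :: "real \<Rightarrow> real \<Rightarrow> real"
  assume D: "open D \<and> Ck_on 2 D (\<lambda>(r, z). w r z)"
  show "\<forall>(t, x, y)\<in>preimage D. \<exists>!\<upsilon>. \<omega> t x y \<upsilon> = w (\<rho> t x y) (\<zeta> t x y)"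
    by (auto simp: preimage_def inv_w_solve)
  fix u
  assume "\<forall>(t, x, y)\<in>preimage D. \<omega> t x y (u t x y) = w (\<rho> t x y) (\<zeta> t x y)"
  hence u: "\<And>t x y. (t, x, y) \<in> preimage D \<Longrightarrow> \<omega> t x y (u t x y) = w (\<rho> t x y) (\<zeta> t x y)"
    by blast
  obtain p1 p2 p11 p12 p22 where p: "\<forall>p\<in>D. has_partials (\<lambda>(r, z). w r z) (p1 p) (p2 p) p"
    "\<forall>p\<in>D. has_partials p1 (p11 p) (p12 p) p" "\<forall>p\<in>D. has_partials p2 (p12 p) (p22 p) p"
    by (rule C2_imp_partials[OF conjunct1[OF D] conjunct2[OF D]])
  have zk: "zk_lhs u t x y = - (b t ^ 6) * reduced_lhs w (\<rho> t x y) (\<zeta> t x y)"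
    if "(t, x, y) \<in> preimage D" for t x y
    by (rule zk_lhs_eq[OF conjunct1[OF D] p[rule_format] u that])
  \<comment> \<open>The factor \<open>- (b t ^ 6)\<close> vanishes nowhere on
    \<open>I\<close>.\<close>
  have iff: "zk_lhs u t x y = 0 \<longleftrightarrow> reduced_lhs w (\<rho> t x y) (\<zeta> t x y) = 0"
    if "(t, x, y) \<in> preimage D" for t x y
    using zk[OF that] a_nonzero[of t] that by (auto simp: preimage_def b_def)
  thus "\<forall>(t, x, y)\<in>preimage D. zk_lhs u t x y = 0 \<longleftrightarrow> reduced_lhs w (\<rho> t x y) (\<zeta> t x y) = 0"
    by blast
  show "(\<forall>(t, x, y)\<in>preimage D. zk_lhs u t x y = 0) \<longleftrightarrow> (\<forall>(r, z)\<in>D. reduced_lhs w r z = 0)"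
  proof (intro iffI)
    assume L: "\<forall>(t, x, y)\<in>preimage D. zk_lhs u t x y = 0"
    have "reduced_lhs w r z = 0" if rz: "(r, z) \<in> D" for r z
    proof -
      obtain t x y where "(t, x, y) \<in> preimage D" "\<rho> t x y = r" "\<zeta> t x y = z"
        by (rule preimage_surj[OF rz])
      thus ?thesis using L iff by blast
    qed
    thus "\<forall>(r, z)\<in>D. reduced_lhs w r z = 0" by blast
  next
    assume "\<forall>(r, z)\<in>D. reduced_lhs w r z = 0"
    thus "\<forall>(t, x, y)\<in>preimage D. zk_lhs u t x y = 0"
      using iff by (auto simp: preimage_def)
  qed
qed

end

theorem mainTheorem4:
  fixes I :: "real set" and f g h G K :: "real \<Rightarrow> real"
  defines "g6 \<equiv> \<lambda>t. 6 * g t" and "h3 \<equiv> \<lambda>t. 3 * h t"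
  assumes "open I" and "connected I" and "I \<noteq> {}"
    and "smooth_on I f" and "smooth_on I g" and "smooth_on I h"
    and "\<forall>t\<in>I. f t \<noteq> 0"
    and "antiderivative_on I G (G_integrand f h3)"
    and "antiderivative_on I K (K_integrand f g6 h3 G)"
  shows "complete_invariants (I \<times> UNIV) (\<lambda>p. field_x g p + field_y h p + field_z f p)
           (\<lambda>(t, x, y, u). inv_r f G t x y)
           (\<lambda>(t, x, y, u). inv_z f h3 G K t x y)
           (\<lambda>(t, x, y, u). inv_w f g6 h3 t x y u)
         \<and> reduces_to I zk_lhs (inv_r f G) (inv_z f h3 G K) (inv_w f g6 h3) reduced_lhs"
proof -
  interpret zk_data I f g h G K
    using assms by unfold_locales auto
  show ?thesis
    unfolding g6_def h3_def by (rule conjI[OF complete_RZW reduction_zk])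
qed

end
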